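(* Let $\lambda>0$ and $\beta\in(0,1]$. The generalized Appell polynomials $C_n^{\lambda,\beta}$, $n\in\mathbb{N}$, generated by the fractional Poisson measure $\pi_{\lambda,\beta}$ are given for any $x\in\mathbb{R}$ in terms of the Bell polynomials as $$C_n^{\lambda,\beta}(x)=\sum_{k=0}^n\binom{n}{k}\Bigg[\sum_{i=0}^{n-k}(-1)^i\,i!\,B_{n-k,i}\big(\tilde M_{\lambda,\beta}(1),\dots,\tilde M_{\lambda,\beta}(n-k-i+1)\big)\Bigg](x)_k,$$ where $(x)_k$ are the falling factorials.
   Context: The Mittag-Leffler function is $E_\beta(z)=\sum_{n=0}^\infty \frac{z^n}{\Gamma(\beta n+1)}$. The fractional Poisson measure $\pi_{\lambda,\beta}$ is the probability measure on $\mathbb{R}$ concentrated on $\mathbb{N}_0=\{0,1,2,\dots\}$ with $\pi_{\lambda,\beta}(\{k\})=\frac{\lambda^k}{k!}E_\beta^{(k)}(-\lambda)$; its Laplace transform is $l_{\pi_{\lambda,\beta}}(z)=E_\beta(\lambda(e^z-1))$. The generalized Appell polynomials $C_n^{\lambda,\beta}$ are defined by $\frac{e^{x\log(1+z)}}{l_{\pi_{\lambda,\beta}}(\log(1+z))}=\frac{e^{x\log(1+z)}}{E_\beta(\lambda z)}=\sum_{n=0}^\infty\frac{z^n}{n!}C_n^{\lambda,\beta}(x)$ for $z$ in a neighborhood of $0\in\mathbb{C}$. $\tilde M_{\lambda,\beta}(m)=\frac{m!\,\lambda^m}{\Gamma(m\beta+1)}$. Falling factorials: $(x)_0=1$, $(x)_m=x(x-1)\cdots(x-m+1)$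 for $m\ge1$. The (partial) Bell polynomials are, for integers $0\le k\le n$, $$B_{n,k}(x_1,\dots,x_{n-k+1})=\sum\frac{n!}{j_1!\cdots j_{n-k+1}!}\left(\frac{x_1}{1!}\right)^{j_1}\cdots\left(\frac{x_{n-k+1}}{(n-k+1)!}\right)^{j_{n-k+1}},$$ the sum being over all non-negative integers $j_1,\dots,j_{n-k+1}$ with $j_1+\dots+j_{n-k+1}=k$ and $j_1+2j_2+\dots+(n-k+1)j_{n-k+1}=n$. *)

theory Defs
  imports "HOL-Probability.Probability"
begin

definition mittag_leffler :: "real \<Rightarrow> 'a::{real_normed_field,banach} \<Rightarrow> 'a" where
  "mittag_leffler \<beta> z = (\<Sum>n. z ^ n / of_real (Gamma (\<beta> * real n + 1)))"

(* For 0 < lam and 0 < beta <= 1 these conditions determine the measure uniquely.  The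
   derivatives are those of the Mittag-Leffler function on the real line. *)
definition fractional_Poisson_measure :: "real \<Rightarrow> real \<Rightarrow> real measure \<Rightarrow> bool" where
  "fractional_Poisson_measure lam \<beta> \<pi> \<longleftrightarrow>
     prob_space \<pi> \<and> sets \<pi> = sets borel \<and> (AE x in \<pi>. x \<in> \<nat>) \<and>
     (\<forall>k::nat. measure \<pi> {real k} =
        lam ^ k / fact k * (deriv ^^ k) (mittag_leffler \<beta> :: real \<Rightarrow> real) (- lam))"

definition laplace_transform :: "real measure \<Rightarrow> complex \<Rightarrow> complex" where
  "laplace_transform \<mu> z = (LINT x|\<mu>. exp (z * complex_of_real x))"

(* The real coefficient sequence of an exponential generating function is unique whenever it
   exists; that it exists is part of what has to be shown for a given measure. *)
definition generalized_Appell :: "real measure \<Rightarrow> nat \<Rightarrow> real \<Rightarrow> real" where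
  "generalized_Appell \<mu> n x =
     (THE c :: nat \<Rightarrow> real. \<forall>\<^sub>F z :: complex in nhds 0.
        (\<lambda>m. z ^ m / fact m * complex_of_real (c m)) sums
          (exp (complex_of_real x * Ln (1 + z)) / laplace_transform \<mu> (Ln (1 + z)))) n"

definition M_tilde :: "real \<Rightarrow> real \<Rightarrow> nat \<Rightarrow> real" where
  "M_tilde lam \<beta> m = fact m * lam ^ m / Gamma (real m * \<beta> + 1)"

definition falling_factorial :: "real \<Rightarrow> nat \<Rightarrow> real" where
  "falling_factorial x m = (\<Prod>i<m. x - real i)"

definition Bell_indices :: "nat \<Rightarrow> nat \<Rightarrow> (nat \<Rightarrow> nat) set" where
  "Bell_indices n k =
     {j \<in> {1..n - k + 1} \<rightarrow>\<^sub>E UNIV.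
        (\<Sum>i = 1..n - k + 1. j i) = k \<and> (\<Sum>i = 1..n - k + 1. i * j i) = n}"

lemma finite_Bell_indices: "finite (Bell_indices n k)"
proof (rule finite_subset)
  show "Bell_indices n k \<subseteq> {1..n - k + 1} \<rightarrow>\<^sub>E {..k}"
  proof
    fix j assume j: "j \<in> Bell_indices n k"
    have "j i \<le> k" if "i \<in> {1..n - k + 1}" for i
      using member_le_sum[of i "{1..n - k + 1}" j] that j by (auto simp: Bell_indices_def)
    then show "j \<in> {1..n - k + 1} \<rightarrow>\<^sub>E {..k}"
      using j by (auto simp: Bell_indices_def PiE_iff)
  qed
  show "finite ({1..n - k + 1} \<rightarrow>\<^sub>E {..k})"
    by (intro finite_PiE) auto
qed

(* The arguments are given as a sequence x, of which only x 1, ..., x (n - k + 1) are used.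
   Meant for k <= n, so that the subtraction does not truncate. *)
definition Bell_poly :: "nat \<Rightarrow> nat \<Rightarrow> (nat \<Rightarrow> real) \<Rightarrow> real" where
  "Bell_poly n k x =
     (\<Sum>j \<in> Bell_indices n k.
        fact n / (\<Prod>i = 1..n - k + 1. fact (j i)) *
        (\<Prod>i = 1..n - k + 1. (x i / fact i) ^ j i))"

end

theory Submission
  imports Defs "HOL-Complex_Analysis.Complex_Analysis"
begin

text \<open>
  The Mittag-Leffler function is entire, so its Taylor series at \<open>- lam\<close> converges everywhere; evaluated
  at \<open>lam * w\<close> it is the series for the Laplace transform of the measure at \<open>Ln (1 + w)\<close>. Hence the
  generating function is \<open>(1 + w) powr x / E (lam * w)\<close>, where \<open>E (lam * w) = 1 + G w\<close>, and its coefficients are the convolution of the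
  binomial series with the reciprocal series \<open>1 / (1 + G) = (\<Sum>i. (- G) ^ i)\<close>. By the multinomial
  theorem, \<open>G ^ i\<close> is up to the factor \<open>fact i\<close> the exponential generating function of the
  \<open>i\<close>-th Bell polynomials.
\<close>

unbundle no vec_syntax
unbundle fps_syntax

section \<open>Powers of formal power series and Bell polynomials\<close>

text \<open>Frees \<open>Bell_indices n k\<close> (the case \<open>I = {1..n - k + 1}\<close>) from
  its interval, which makes induction on the index set possible.\<close>

definition weighted_profiles :: "nat set \<Rightarrow> nat \<Rightarrow> nat \<Rightarrow> (nat \<Rightarrow> nat) set" where
  "weighted_profiles I k n = {j \<in> I \<rightarrow>\<^sub>E UNIV. (\<Sum>i\<in>I. j i) = k \<and> (\<Sum>i\<in>I. i * j i) = n}"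

lemma finite_weighted_profiles:
  assumes "finite I"
  shows "finite (weighted_profiles I k n)"
proof (rule finite_subset)
  show "weighted_profiles I k n \<subseteq> I \<rightarrow>\<^sub>E {..k}"
  proof
    fix j assume j: "j \<in> weighted_profiles I k n"
    have "j i \<le> k" if "i \<in> I" for i
      using member_le_sum[of i I j] that j assms by (auto simp: weighted_profiles_def)
    then show "j \<in> I \<rightarrow>\<^sub>E {..k}"
      using j by (auto simp: weighted_profiles_def PiE_iff)
  qed
  show "finite (I \<rightarrow>\<^sub>E {..k})"
    using assms by (intro finite_PiE) auto
qed

text \<open>Profiles are sorted by their value \<open>l\<close> at the new index. The range of
  \<open>l\<close> keeps both subtractions from truncating.\<close>

lemma sum_weighted_profiles_insert:
  fixes f :: "(nat \<Rightarrow> nat) \<Rightarrow> 'a::comm_monoid_add"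
  assumes "finite I" "a \<notin> I"
  shows "(\<Sum>j\<in>weighted_profiles (insert a I) k n. f j) =
    (\<Sum>l | l \<le> k \<and> a * l \<le> n. \<Sum>j\<in>weighted_profiles I (k - l) (n - a * l). f (j(a := l)))"
proof -
  have eqs: "(\<Sum>i\<in>I. (j(a := l)) i) = (\<Sum>i\<in>I. j i)" "(\<Sum>i\<in>I. i * (j(a := l)) i) = (\<Sum>i\<in>I. i * j i)"
    for j :: "nat \<Rightarrow> nat" and l
    using assms by (auto intro!: sum.cong)
  have "(\<Sum>j\<in>weighted_profiles (insert a I) k n. f j) =
    (\<Sum>(l, j)\<in>(SIGMA l:{l. l \<le> k \<and> a * l \<le> n}. weighted_profiles I (k - l) (n - a * l)). f (j(a := l)))"
    \<comment> \<open>The inverse map resets the entry at \<open>a\<close> to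
      \<open>undefined\<close>, the value of an extensional function outside
      \<open>I\<close>.\<close>
    by (rule sum.reindex_bij_witness[of _ "\<lambda>(l, j). j(a := l)" "\<lambda>j. (j a, j(a := undefined))"])
      (use assms in \<open>auto simp: weighted_profiles_def PiE_iff extensional_def eqs simp del: fun_upd_apply,
       auto simp: fun_eq_iff\<close>)
  also have "\<dots> = (\<Sum>l | l \<le> k \<and> a * l \<le> n. \<Sum>j\<in>weighted_profiles I (k - l) (n - a * l). f (j(a := l)))"
    using assms by (subst sum.Sigma) (auto intro!: finite_weighted_profiles)
  finally show ?thesis .
qed

text \<open>The multinomial theorem, read off at one degree: the profile \<open>j\<close> counts how
  often each monomial is chosen, and its weight is the resulting exponent of \<open>fps_X\<close>.
  The induction splits off one monomial by the binomial theorem.\<close>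

lemma fps_nth_power_sum_monomials:
  fixes c :: "nat \<Rightarrow> 'a::field_char_0"
  assumes "finite I"
  shows "((\<Sum>i\<in>I. fps_const (c i) * fps_X ^ i) ^ k) $ n =
    fact k * (\<Sum>j\<in>weighted_profiles I k n. \<Prod>i\<in>I. c i ^ j i / fact (j i))"
  using assms
proof (induction I arbitrary: k n)
  case empty
  show ?case by (auto simp: weighted_profiles_def power_0_left)
next
  case (insert a I)
  define A where "A = (\<Sum>i\<in>I. fps_const (c i) * fps_X ^ i)"
  define P where "P = (\<lambda>k n. \<Sum>j\<in>weighted_profiles I k n. \<Prod>i\<in>I. c i ^ j i / fact (j i))"
  have prod_eq: "(\<Prod>i\<in>I. c i ^ (if i = a then l else j i) / fact (if i = a then l else j i)) =
      (\<Prod>i\<in>I. c i ^ j i / fact (j i))" for j :: "nat \<Rightarrow> nat" and l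
    using insert.hyps by (intro prod.cong) auto
  \<comment> \<open>The power of \<open>fps_X\<close> shifts the coefficient by
    \<open>a * l\<close>; the \<open>fact (k - l)\<close> from the induction hypothesis cancels
    against the binomial coefficient.\<close>
  have term_eq: "(of_nat (k choose l) * (fps_const (c a) * fps_X ^ a) ^ l * A ^ (k - l)) $ n =
      (if a * l \<le> n then fact k * (c a ^ l / fact l * P (k - l) (n - a * l)) else 0)"
    if "l \<le> k" for l
  proof -
    have "of_nat (k choose l) * (fps_const (c a) * fps_X ^ a) ^ l * A ^ (k - l) =
      fps_const (of_nat (k choose l) * c a ^ l) * (fps_X ^ (a * l) * A ^ (k - l))"
      by (simp add: power_mult_distrib power_mult fps_of_nat flip: fps_const_mult fps_const_power)
    moreover have "(A ^ m) $ p = fact m * P m p" for m p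
      unfolding A_def P_def by (rule insert.IH)
    ultimately show ?thesis
      using that by (simp only: fps_mult_left_const_nth fps_X_power_mult_nth) (simp add: binomial_fact)
  qed
  have "(\<Sum>i\<in>insert a I. fps_const (c i) * fps_X ^ i) ^ k =
      (\<Sum>l\<le>k. of_nat (k choose l) * (fps_const (c a) * fps_X ^ a) ^ l * A ^ (k - l))"
    using insert.hyps by (simp add: A_def binomial_ring)
  then have "((\<Sum>i\<in>insert a I. fps_const (c i) * fps_X ^ i) ^ k) $ n =
      (\<Sum>l\<le>k. if a * l \<le> n then fact k * (c a ^ l / fact l * P (k - l) (n - a * l)) else 0)"
    by (simp only: fps_sum_nth) (rule sum.cong, auto simp: term_eq)
  also have "\<dots> = (\<Sum>l | l \<le> k \<and> a * l \<le> n. fact k * (c a ^ l / fact l * P (k - l) (n - a * l)))"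
    by (intro sum.mono_neutral_cong_right) auto
  also have "\<dots> = fact k * (\<Sum>l | l \<le> k \<and> a * l \<le> n. \<Sum>j\<in>weighted_profiles I (k - l) (n - a * l).
      \<Prod>i\<in>insert a I. c i ^ (j(a := l)) i / fact ((j(a := l)) i))"
    using insert.hyps by (simp add: P_def prod_eq sum_distrib_left sum_divide_distrib mult.assoc)
  also have "\<dots> = fact k * (\<Sum>j\<in>weighted_profiles (insert a I) k n. \<Prod>i\<in>insert a I. c i ^ j i / fact (j i))"
    using insert.hyps by (subst sum_weighted_profiles_insert) auto
  finally show ?case .
qed

text \<open>Without constant terms, each of the other \<open>k - 1\<close> factors uses up at least
  one degree, so no factor contributes beyond degree \<open>n - k + 1\<close>. This matches the
  number of arguments of \<open>Bell_poly n k\<close>.\<close>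

lemma fps_nth_power_cong:
  fixes F G :: "'a::comm_ring_1 fps"
  assumes "F $ 0 = 0" "G $ 0 = 0" "k \<le> n" "\<And>i. i \<le> n - k + 1 \<Longrightarrow> F $ i = G $ i"
  shows "(F ^ k) $ n = (G ^ k) $ n"
  using assms(3,4)
proof (induction k arbitrary: n)
  case (Suc k)
  have "F $ i * (F ^ k) $ (n - i) = G $ i * (G ^ k) $ (n - i)" if "i \<le> n" for i
  proof -
    \<comment> \<open>The outer cases vanish on both sides: the first by the zero constant terms,
      the second because a \<open>k\<close>-th power starts in degree \<open>k\<close>.\<close>
    consider "i = 0" | "n - i < k" | "i > 0" "k \<le> n - i" by linarith
    then show ?thesis
    proof cases
      case 2
      then show ?thesis
        using startsby_zero_power_prefix[OF assms(1)] startsby_zero_power_prefix[OF assms(2)] by simp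
    next
      case 3
      then have "(F ^ k) $ (n - i) = (G ^ k) $ (n - i)"
        using that by (intro Suc.IH Suc.prems) auto
      moreover have "F $ i = G $ i"
        using 3 that by (intro Suc.prems) auto
      ultimately show ?thesis by simp
    qed (simp add: assms)
  qed
  then show ?case by (auto simp: fps_mult_nth intro!: sum.cong)
qed simp

lemma fps_nth_power_eq_Bell_poly:
  fixes G :: "'a::real_normed_field fps" and y :: "nat \<Rightarrow> real"
  assumes "G $ 0 = 0" "\<And>i. i > 0 \<Longrightarrow> G $ i = of_real (y i / fact i)" "k \<le> n"
  shows "(G ^ k) $ n = of_real (fact k / fact n * Bell_poly n k y)"
proof -
  define N where "N = n - k + 1"
  \<comment> \<open>Truncating \<open>G\<close> at degree \<open>N\<close> leaves the wanted
    coefficient unchanged and gives a polynomial to which the multinomial formula applies.\<close>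
  define H where "H = (\<Sum>i=1..N. fps_const (of_real (y i / fact i) :: 'a) * fps_X ^ i)"
  have H_nth: "H $ m = (if m \<in> {1..N} then of_real (y m / fact m) else 0)" for m
    by (simp add: H_def fps_sum_nth fps_X_power_nth if_distrib del: of_real_divide cong: if_cong)
  have "G $ i = H $ i" if "i \<le> N" for i
    using that assms by (cases "i = 0") (auto simp: H_nth)
  then have "(G ^ k) $ n = (H ^ k) $ n"
    using assms by (intro fps_nth_power_cong) (auto simp: H_nth N_def)
  also have "\<dots> = of_real (fact k / fact n * Bell_poly n k y)"
    unfolding H_def by (subst fps_nth_power_sum_monomials)
      (simp_all add: Bell_poly_def N_def Bell_indices_def weighted_profiles_def sum_distrib_left prod_dividef)
  finally show ?thesis .
qed

text \<open>The geometric series: with \<open>G = M - 1\<close>, the reciprocal of \<open>M\<close>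
  is \<open>1 / (1 - fps_X)\<close> composed with \<open>- G\<close>, which is legitimate because
  \<open>G\<close> has no constant term.\<close>

lemma fps_nth_inverse_eq_sum_Bell_poly:
  fixes M :: "'a::real_normed_field fps" and y :: "nat \<Rightarrow> real"
  assumes "M $ 0 = 1" "\<And>i. i > 0 \<Longrightarrow> M $ i = of_real (y i / fact i)"
  shows "inverse M $ n = of_real ((\<Sum>i=0..n. (-1) ^ i * fact i * Bell_poly n i y) / fact n)"
proof -
  define G where "G = M - 1"
  have G: "G $ 0 = 0" "\<And>i. i > 0 \<Longrightarrow> G $ i = of_real (y i / fact i)"
    using assms by (auto simp: G_def)
  have "inverse M = inverse ((1 - fps_X) oo (- G))"
    by (simp add: fps_compose_sub_distrib G_def assms)
  also have "\<dots> = inverse (1 - fps_X) oo (- G)"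
    using G by (subst fps_inverse_compose) auto
  also have "inverse (1 - fps_X :: 'a fps) = Abs_fps (\<lambda>_. 1)"
    by (metis fps_inverse_gp' fps_inverse_idempotent fps_nth_Abs_fps one_neq_zero)
  \<comment> \<open>The sum stops at \<open>n\<close> because the \<open>i\<close>-th power starts
    in degree \<open>i\<close>.\<close>
  finally have "inverse M $ n = (\<Sum>i=0..n. ((- G) ^ i) $ n)"
    by (simp add: fps_compose_nth)
  also have "\<dots> = (\<Sum>i=0..n. (-1) ^ i * (G ^ i) $ n)"
    by (intro sum.cong refl) (simp add: uminus_power_if)
  also have "\<dots> = (\<Sum>i=0..n. of_real ((-1) ^ i * (fact i / fact n * Bell_poly n i y)))"
    using G by (intro sum.cong) (auto simp: fps_nth_power_eq_Bell_poly)
  finally show ?thesis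
    by (simp add: sum_divide_distrib mult.assoc)
qed

lemma gchoose_eq_falling_factorial:
  "(of_real x :: 'a::real_field) gchoose k = of_real (falling_factorial x k / fact k)"
  by (simp add: falling_factorial_def gbinomial_prod_rev atLeast0LessThan)

section \<open>Growth of Gamma and the Mittag-Leffler function as an entire function\<close>

text \<open>Euler's integral is cut down to \<open>{R..R + 1}\<close>, where both factors of the
  integrand are bounded below by their values at an endpoint. As \<open>R\<close> is arbitrary,
  Gamma outgrows every exponential.\<close>

lemma Gamma_ge_powr_mult_exp:
  fixes R y :: real
  assumes "R > 0" "y \<ge> 0"
  shows "R powr y * exp (- (R + 1)) \<le> Gamma (y + 1)"
proof -
  define f where "f = (\<lambda>t::real. t powr y / exp t)"
  have int: "f integrable_on {R..R + 1}"
    unfolding f_def using assms by (intro integrable_continuous_real continuous_intros) auto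
  have "R powr y * exp (- (R + 1)) \<le> f t" if "t \<in> {R..R + 1}" for t
    using that assms unfolding f_def divide_inverse exp_minus[symmetric]
    by (intro mult_mono powr_mono2) auto
  then have "((R + 1) - R) *\<^sub>R (R powr y * exp (- (R + 1))) \<le> integral {R..R + 1} f"
    using has_integral_const_real[of "R powr y * exp (- (R + 1))" R "R + 1"] int
    by (intro has_integral_le[OF _ integrable_integral[OF int]]) auto
  also have "\<dots> \<le> Gamma (y + 1)"
  proof (rule has_integral_subset_le)
    show "(f has_integral Gamma (y + 1)) {0..}"
      using Gamma_integral_real[of "y + 1"] assms by (simp add: f_def)
  qed (use assms integrable_integral[OF int] in \<open>auto simp: f_def\<close>)
  finally show ?thesis by simp
qed

lemma summable_mittag_leffler:
  fixes z :: "'a::{real_normed_field,banach}"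
  assumes "\<beta> > 0"
  shows "summable (\<lambda>n. z ^ n / of_real (Gamma (\<beta> * real n + 1)))"
proof (rule summable_comparison_test')
  \<comment> \<open>\<open>R\<close> is chosen so that \<open>R powr \<beta> = Q\<close>; then Gamma
    dominates \<open>Q ^ n\<close> up to a constant. Since \<open>norm z \<le> Q / 2\<close>, the
    ratio of the majorant is \<open>1 / 2\<close>; the summand 1 keeps \<open>Q\<close> positive for
    \<open>z = 0\<close>.\<close>
  define Q where "Q = 2 * (norm z + 1)"
  define R where "R = Q powr (1 / \<beta>)"
  have Q: "Q > 0"
    by (simp add: Q_def add_nonneg_pos)
  have R: "R > 0" "\<And>n. R powr (\<beta> * real n) = Q ^ n"
    using Q assms by (auto simp: R_def powr_powr powr_realpow)
  show "summable (\<lambda>n. exp (R + 1) * (1 / 2 :: real) ^ n)"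
    by (intro summable_mult summable_geometric) auto
  fix n :: nat
  have Gamma: "Q ^ n * exp (- (R + 1)) \<le> Gamma (\<beta> * real n + 1)"
    using Gamma_ge_powr_mult_exp[of R "\<beta> * real n"] R assms by simp
  have "norm (z ^ n / of_real (Gamma (\<beta> * real n + 1))) = norm z ^ n / Gamma (\<beta> * real n + 1)"
    using assms by (simp add: norm_divide norm_power add_nonneg_pos)
  also have "\<dots> \<le> (Q / 2) ^ n / (Q ^ n * exp (- (R + 1)))"
    using Q Gamma by (intro frac_le power_mono) (auto simp: Q_def)
  also have "\<dots> = exp (R + 1) * (1 / 2) ^ n"
    unfolding exp_minus using Q by (simp add: power_divide field_simps)
  finally show "norm (z ^ n / of_real (Gamma (\<beta> * real n + 1))) \<le> exp (R + 1) * (1 / 2) ^ n" .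
qed

definition mittag_leffler_fps :: "real \<Rightarrow> 'a::{real_normed_field,banach} fps" where
  "mittag_leffler_fps \<beta> = Abs_fps (\<lambda>n. 1 / of_real (Gamma (\<beta> * real n + 1)))"

lemma fps_conv_radius_mittag_leffler [simp]:
  "\<beta> > 0 \<Longrightarrow> fps_conv_radius (mittag_leffler_fps \<beta>) = \<infinity>"
  unfolding fps_conv_radius_def
  by (rule conv_radius_inftyI'') (use summable_mittag_leffler in \<open>simp add: mittag_leffler_fps_def\<close>)

lemma eval_fps_mittag_leffler [simp]: "eval_fps (mittag_leffler_fps \<beta>) = mittag_leffler \<beta>"
  by (simp add: fun_eq_iff eval_fps_def mittag_leffler_def mittag_leffler_fps_def)

lemma mittag_leffler_holomorphic [holomorphic_intros]:
  assumes "\<beta> > 0"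
  shows "mittag_leffler \<beta> holomorphic_on A"
  using holomorphic_on_eval_fps[of A "mittag_leffler_fps \<beta>"] assms by simp

lemma mittag_leffler_of_real:
  assumes "\<beta> > 0"
  shows "(mittag_leffler \<beta> (of_real t) :: 'a::{real_normed_field,banach}) = of_real (mittag_leffler \<beta> t)"
proof -
  have "summable (\<lambda>n. t ^ n / Gamma (\<beta> * real n + 1))"
    using summable_mittag_leffler[OF assms, of t] by simp
  then show ?thesis
    by (simp add: mittag_leffler_def suminf_of_real)
qed

section \<open>Laplace transform of the fractional Poisson measure\<close>

text \<open>Along the real line the imaginary part of \<open>f\<close> is constantly 0, so the
  complex derivative is real there. This connects the real derivatives that define the measure with
  complex Taylor coefficients.\<close>

lemma deriv_of_real_eq:
  fixes f :: "complex \<Rightarrow> complex" and g :: "real \<Rightarrow> real"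
  assumes "f holomorphic_on UNIV" "\<And>t. f (of_real t) = of_real (g t)"
  shows "deriv f (of_real t) = of_real (deriv g t)"
proof -
  have "(f has_field_derivative deriv f (of_real t)) (at (of_real t))"
    using assms(1) by (intro holomorphic_derivI) auto
  then have "((\<lambda>s. f (of_real s)) has_vector_derivative deriv f (of_real t)) (at t)"
    by (rule has_vector_derivative_real_field)
  then have "((\<lambda>s. complex_of_real (g s)) has_vector_derivative deriv f (of_real t)) (at t)"
    using assms(2) by simp
  then have "(g has_real_derivative Re (deriv f (of_real t))) (at t)"
    "((\<lambda>_. 0) has_real_derivative Im (deriv f (of_real t))) (at t)"
    by (auto simp: has_vector_derivative_complex_iff)
  moreover from this(2) have "Im (deriv f (of_real t)) = 0"
    using DERIV_unique DERIV_const by blast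
  ultimately show ?thesis
    by (simp add: DERIV_imp_deriv complex_eq_iff)
qed

lemma higher_deriv_of_real_eq:
  fixes f :: "complex \<Rightarrow> complex" and g :: "real \<Rightarrow> real"
  assumes "f holomorphic_on UNIV" "\<And>t. f (of_real t) = of_real (g t)"
  shows "(deriv ^^ k) f (of_real t) = of_real ((deriv ^^ k) g t)"
proof (induction k arbitrary: t)
  case (Suc k)
  then show ?case
    using assms(1) by (auto intro!: deriv_of_real_eq holomorphic_higher_deriv)
qed (simp add: assms)

text \<open>Almost everywhere \<open>h\<close> is the sum of its restrictions to single natural
  numbers; the summability hypothesis permits exchanging sum and integral.\<close>

lemma sums_integral_AE_Nats:
  fixes h :: "real \<Rightarrow> 'b::{banach,second_countable_topology}"
  assumes "finite_measure M" "sets M = sets borel" "AE x in M. x \<in> \<nat>"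
    and "h \<in> borel_measurable borel"
    and "summable (\<lambda>k. measure M {real k} * norm (h (real k)))"
  shows "(\<lambda>k. measure M {real k} *\<^sub>R h (real k)) sums (LINT x|M. h x)"
proof -
  interpret finite_measure M by fact
  define F where "F = (\<lambda>k x. indicator {real k} x *\<^sub>R h (real k))"
  have [measurable_cong]: "sets M = sets borel" by fact
  have [measurable]: "{real k} \<in> sets M" for k
    using assms(2) by simp
  have space: "space M = UNIV"
    using assms(2) sets_eq_imp_space_eq by fastforce
  have indicator: "integrable M (indicator {real k} :: real \<Rightarrow> real)" for k
    by (intro integrable_real_indicator) (auto simp: emeasure_eq_measure)
  then have integrable: "integrable M (F k)" for k
    unfolding F_def by (intro integrable_scaleR_left)
  have pt: "F k x = (if k = m then h (real k) else 0)" if "x = real m" for k m x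
    using that by (auto simp: F_def)
  have F_sums: "(\<lambda>k. F k x) sums h x" if "x \<in> \<nat>" for x
    using that sums_single[of _ "\<lambda>k. h (real k)"] by (auto simp: pt elim!: Nats_cases)
  have "(\<lambda>k. integral\<^sup>L M (F k)) sums (LINT x|M. (\<Sum>k. F k x))"
  proof (rule sums_integral[OF integrable])
    show "AE x in M. summable (\<lambda>k. norm (F k x))"
      using assms(3)
    proof eventually_elim
      case (elim x)
      then obtain m where "x = real m" by (auto elim: Nats_cases)
      then show ?case by (intro summable_finite[of "{m}"]) (auto simp: pt)
    qed
    show "summable (\<lambda>k. LINT x|M. norm (F k x))"
      using assms(5) by (simp add: F_def space)
  qed
  also have "(\<lambda>k. integral\<^sup>L M (F k)) = (\<lambda>k. measure M {real k} *\<^sub>R h (real k))"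
    unfolding F_def by (subst integral_scaleR_left) (simp_all add: indicator space)
  \<comment> \<open>Outside \<nat> the series is 0, so its agreement with \<open>h\<close> is
    claimed only almost everywhere.\<close>
  also have "(LINT x|M. (\<Sum>k. F k x)) = (LINT x|M. h x)"
  proof (rule integral_cong_AE)
    show "AE x in M. (\<Sum>k. F k x) = h x"
      using assms(3) by eventually_elim (use F_sums in \<open>simp add: sums_iff\<close>)
    show "(\<lambda>x. \<Sum>k. F k x) \<in> borel_measurable M"
      using integrable by (intro borel_measurable_suminf) auto
    show "h \<in> borel_measurable M"
      using assms(4) by measurable
  qed
  finally show ?thesis .
qed

text \<open>At \<open>Ln u\<close> the Laplace transform is the probability generating function at
  \<open>u\<close>, which is the Taylor series of the Mittag-Leffler function about
  \<open>- lam\<close>. The case \<open>w = -1\<close> is excluded because \<open>exp (Ln 0)\<close>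
  is not 0.\<close>

lemma laplace_transform_fractional_Poisson:
  assumes "\<beta> > 0" "fractional_Poisson_measure lam \<beta> \<pi>" "w \<noteq> -1"
  shows "laplace_transform \<pi> (Ln (1 + w)) = mittag_leffler \<beta> (of_real lam * w)"
proof -
  define D where "D = (\<lambda>k. (deriv ^^ k) (mittag_leffler \<beta> :: real \<Rightarrow> real) (- lam))"
  have prob: "prob_space \<pi>" and sets: "sets \<pi> = sets borel" and Nats: "AE x in \<pi>. x \<in> \<nat>"
    and meas: "\<And>k. measure \<pi> {real k} = lam ^ k / fact k * D k"
    using assms(2) by (auto simp: fractional_Poisson_measure_def D_def)
  have deriv_eq: "(deriv ^^ k) (mittag_leffler \<beta>) (complex_of_real (- lam)) = of_real (D k)" for k
    unfolding D_def using assms(1)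
    by (intro higher_deriv_of_real_eq mittag_leffler_holomorphic mittag_leffler_of_real)
  \<comment> \<open>At the point \<open>lam * (u - 1)\<close> the increment from
    \<open>- lam\<close> is \<open>lam * u\<close>, so \<open>lam ^ k\<close> joins the derivative
    to form the mass at \<open>k\<close>.\<close>
  have taylor: "(\<lambda>k. of_real (measure \<pi> {real k}) * u ^ k) sums mittag_leffler \<beta> (of_real lam * (u - 1))"
    for u :: complex
  proof -
    have arg_eq: "of_real lam * (u - 1) - of_real (- lam) = of_real lam * u"
      by (simp add: algebra_simps)
    have "(\<lambda>k. (deriv ^^ k) (mittag_leffler \<beta>) (of_real (- lam)) / fact k *
        (of_real lam * (u - 1) - of_real (- lam)) ^ k) sums mittag_leffler \<beta> (of_real lam * (u - 1))"
      \<comment> \<open>Any disc around \<open>- lam\<close> containing the point will do, as the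
        function is entire.\<close>
      by (rule holomorphic_power_series[where r = "dist (of_real (- lam)) (of_real lam * (u - 1)) + 1"])
        (use assms(1) in \<open>auto intro: holomorphic_intros\<close>)
    also have "(\<lambda>k. (deriv ^^ k) (mittag_leffler \<beta>) (of_real (- lam)) / fact k *
        (of_real lam * (u - 1) - of_real (- lam)) ^ k) = (\<lambda>k. of_real (measure \<pi> {real k}) * u ^ k)"
      unfolding deriv_eq arg_eq by (simp add: meas power_mult_distrib mult_ac)
    finally show ?thesis .
  qed
  have exp_eq: "exp (Ln (1 + w) * complex_of_real (real k)) = (1 + w) ^ k" for k
    using assms(3) by (simp add: exp_of_nat2_mult exp_Ln add_eq_0_iff)
  \<comment> \<open>Taylor's series at the real point \<open>norm (1 + w)\<close> is the series of
    norms, which gives the absolute summability needed to integrate termwise.\<close>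
  have "summable (\<lambda>k. complex_of_real (measure \<pi> {real k} * norm (1 + w) ^ k))"
    using taylor[of "of_real (norm (1 + w))"] by (simp add: sums_iff)
  then have "summable (\<lambda>k. measure \<pi> {real k} * norm (exp (Ln (1 + w) * complex_of_real (real k))))"
    by (simp only: summable_of_real_iff exp_eq norm_power)
  then have "(\<lambda>k. measure \<pi> {real k} *\<^sub>R exp (Ln (1 + w) * complex_of_real (real k))) sums
      laplace_transform \<pi> (Ln (1 + w))"
    unfolding laplace_transform_def
    using prob_space.finite_measure[OF prob] sets Nats by (intro sums_integral_AE_Nats) auto
  with taylor[of "1 + w"] show ?thesis
    by (simp only: exp_eq scaleR_conv_of_real add_diff_cancel_left') (rule sums_unique2)
qed

section \<open>Expansion of the generating function\<close>

text \<open>Translates the pointwise convergence in \<open>generalized_Appell\<close> into the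
  calculus of formal expansions.\<close>

lemma has_fps_expansion_iff_sums:
  fixes F :: "'a::{banach,real_normed_div_algebra} fps"
  shows "f has_fps_expansion F \<longleftrightarrow> (\<forall>\<^sub>F z in nhds 0. (\<lambda>n. F $ n * z ^ n) sums f z)"
proof
  assume f: "f has_fps_expansion F"
  then have "\<forall>\<^sub>F z in nhds 0. z \<in> eball 0 (fps_conv_radius F)"
    by (intro eventually_nhds_in_open) (auto simp: has_fps_expansion_def zero_ereal_def)
  moreover have "\<forall>\<^sub>F z in nhds 0. eval_fps F z = f z"
    using f by (simp add: has_fps_expansion_def)
  ultimately show "\<forall>\<^sub>F z in nhds 0. (\<lambda>n. F $ n * z ^ n) sums f z"
  proof eventually_elim
    case (elim z)
    then show ?case
      using sums_eval_fps[of z F] by simp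
  qed
qed (rule has_fps_expansionI)

text \<open>Exhibiting one expansion settles the \<open>THE\<close>: complex power series
  coefficients are unique and \<open>of_real\<close> is injective.\<close>

lemma generalized_Appell_eqI:
  fixes c :: "nat \<Rightarrow> real"
  assumes "(\<lambda>z. exp (complex_of_real x * Ln (1 + z)) / laplace_transform \<mu> (Ln (1 + z)))
    has_fps_expansion Abs_fps (\<lambda>m. of_real (c m / fact m))"
  shows "generalized_Appell \<mu> n x = c n"
proof -
  define f where "f = (\<lambda>z. exp (complex_of_real x * Ln (1 + z)) / laplace_transform \<mu> (Ln (1 + z)))"
  have iff: "(\<forall>\<^sub>F z in nhds 0. (\<lambda>m. z ^ m / fact m * complex_of_real (d m)) sums f z) \<longleftrightarrow>
      f has_fps_expansion Abs_fps (\<lambda>m. of_real (d m / fact m))" for d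
    by (simp add: has_fps_expansion_iff_sums mult_ac)
  have f: "f has_fps_expansion Abs_fps (\<lambda>m. of_real (c m / fact m))"
    using assms by (simp add: f_def)
  have "(THE d. \<forall>\<^sub>F z in nhds 0. (\<lambda>m. z ^ m / fact m * complex_of_real (d m)) sums f z) = c"
    unfolding iff
  proof (rule the_equality, rule f, rule ext)
    fix d m
    assume "f has_fps_expansion Abs_fps (\<lambda>m. of_real (d m / fact m))"
    from fps_expansion_unique_complex[OF this f]
    have "complex_of_real (d m / fact m) = of_real (c m / fact m)"
      by (metis fps_nth_Abs_fps)
    then show "d m = c m"
      unfolding of_real_eq_iff by simp
  qed
  then show ?thesis
    by (simp add: generalized_Appell_def f_def)
qed

theorem theoremB15:
  fixes lam \<beta> x :: real and \<pi> :: "real measure" and n :: nat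
  assumes "lam > 0"
    and "\<beta> \<in> {0<..1}"
    and "fractional_Poisson_measure lam \<beta> \<pi>"
  shows "generalized_Appell \<pi> n x =
    (\<Sum>k = 0..n. real (n choose k) *
       (\<Sum>i = 0..n - k. (-1) ^ i * fact i * Bell_poly (n - k) i (M_tilde lam \<beta>)) *
       falling_factorial x k)"
proof -
  have \<beta>: "\<beta> > 0" using assms(2) by simp
  define b where "b = (\<lambda>m. \<Sum>i=0..m. (-1) ^ i * fact i * Bell_poly m i (M_tilde lam \<beta>))"
  \<comment> \<open>The factorial in \<open>M_tilde\<close> cancels, which leaves the Mittag-Leffler
    series at \<open>lam * z\<close>.\<close>
  define M :: "complex fps" where "M = Abs_fps (\<lambda>m. of_real (M_tilde lam \<beta> m / fact m))"
  have M0: "M $ 0 = 1"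
    by (simp add: M_def M_tilde_def)
  have "(\<lambda>m. M $ m * z ^ m) sums mittag_leffler \<beta> (of_real lam * z)" for z
    using summable_sums[OF summable_mittag_leffler[OF \<beta>, of "of_real lam * z"]]
    by (simp add: M_def M_tilde_def mittag_leffler_def power_mult_distrib mult.commute)
  then have M: "(\<lambda>z. mittag_leffler \<beta> (of_real lam * z)) has_fps_expansion M"
    by (simp add: has_fps_expansion_iff_sums)
  have inverse_M: "inverse M $ m = of_real (b m / fact m)" for m
    unfolding b_def by (rule fps_nth_inverse_eq_sum_Bell_poly) (simp_all add: M0, simp add: M_def)
  have "(\<lambda>z. (1 + z) powr of_real x * inverse (mittag_leffler \<beta> (of_real lam * z))) has_fps_expansion
      fps_binomial (of_real x) * inverse M"
    using M M0 by (intro fps_expansion_intros) auto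
  also have "fps_binomial (of_real x) * inverse M =
      Abs_fps (\<lambda>m. of_real ((\<Sum>k=0..m. real (m choose k) * b (m - k) * falling_factorial x k) / fact m))"
  proof (rule fps_ext)
    fix m
    have "(fps_binomial (of_real x) * inverse M) $ m =
        (\<Sum>k=0..m. of_real (falling_factorial x k / fact k * (b (m - k) / fact (m - k))))"
      by (simp add: fps_mult_nth inverse_M gchoose_eq_falling_factorial)
    \<comment> \<open>Pulling out \<open>1 / fact m\<close> turns the two factorials of the
      convolution into \<open>m choose k\<close>.\<close>
    also have "\<dots> = (\<Sum>k=0..m. of_real (real (m choose k) * b (m - k) * falling_factorial x k / fact m))"
      by (intro sum.cong refl arg_cong[where f = of_real]) (simp add: binomial_fact)
    finally show "(fps_binomial (of_real x) * inverse M) $ m = Abs_fps (\<lambda>m. of_real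
        ((\<Sum>k=0..m. real (m choose k) * b (m - k) * falling_factorial x k) / fact m)) $ m"
      by (simp add: sum_divide_distrib)
  qed
  also have "(\<lambda>z. (1 + z) powr of_real x * inverse (mittag_leffler \<beta> (of_real lam * z)))
        has_fps_expansion \<dots> \<longleftrightarrow>
      (\<lambda>z. exp (complex_of_real x * Ln (1 + z)) / laplace_transform \<pi> (Ln (1 + z)))
        has_fps_expansion \<dots>"
  \<comment> \<open>Agreement near 0 suffices. There \<open>z \<noteq> -1\<close>, so the Laplace
    formula applies and \<open>powr\<close> unfolds to the exponential instead of its default 0 at
    base 0.\<close>
  proof (rule has_fps_expansion_cong[OF _ refl])
    have "\<forall>\<^sub>F z in nhds (0 :: complex). z \<noteq> - 1"
      by (rule t1_space_nhds) simp
    then show "\<forall>\<^sub>F z in nhds 0. (1 + z) powr of_real x * inverse (mittag_leffler \<beta> (of_real lam * z)) =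
        exp (complex_of_real x * Ln (1 + z)) / laplace_transform \<pi> (Ln (1 + z))"
      by eventually_elim
        (simp add: laplace_transform_fractional_Poisson[OF \<beta> assms(3)] powr_def divide_inverse add_eq_0_iff)
  qed
  finally show ?thesis
    unfolding b_def by (rule generalized_Appell_eqI)
qed

end
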